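(* Let $\alpha,\beta,\lambda\in[0,1]$, and consider the Constrained Hybrid Borda (CHB) rule $F_{\mathrm{CHB}}$ with these parameters, applied to profiles of $k$ strict complete rankings of the $m$ candidates $p_1,\dots,p_m$. Then CHB exhibits fine-grained responsiveness: for every candidate $p_j$ there exists a profile $\Pi$ with $F_{\mathrm{CHB}}(\Pi)\neq p_j$ and a profile $\Pi'$ obtained from $\Pi$ by a single minimal $p_j$-improvement such that $F_{\mathrm{CHB}}(\Pi')=p_j$.
   Context: Let $\mathcal P=\{p_1,\dots,p_m\}$. A profile $\Pi=(R_1,\dots,R_k)$ is a list of $k$ ballots, each a strict complete ranking of $\mathcal P$. The Borda score $B(p_j)$ is the sum over ballots of the points of $p_j$, where a candidate in position $i$ of a ballot ($i=1$ is the top) gets $m-i$ points. The first-place count $t_j$ is the number of ballots that rank $p_j$ first. Let $B_{\max}=\max_j B(p_j)$. A candidate is $\alpha$-popular if $t_j\ge\lceil\alpha k\rceil$. The hybrid score is $$H(p_j)=(1-\lambda)\frac{B(p_j)}{k(m-1)}+\lambda\frac{t_j}{k}.$$ CHB selects a winner as follows. (1) Let $p_{B}$ be the candidate of maximum Borda score. If $p_B$ is $\alpha$-popular, $p_B$ wins. (2) Otherwise, form the set of eligible candidates, namely all $p_j$ that are $\alpha$-popular and satisfy $B(p_j)\ge\beta B_{\max}$. If this set is non-empty, the eligible candidate with the highest hybrid score wins. (3) If the eligible set is empty, $p_B$ wins. At every stage ties are broken lexicographically: the tied candidate with the lowest index is chosen. A minimal $p_j$-improvement is a change to a single voter's ballot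 that increases the Borda score $B(p_j)$ by exactly one point without changing the first-place count $t_j$.
   Formalization: Assumes at least three candidates (m ≥ 3) and at least two ballots (k ≥ 2); the claim fails otherwise: for m = 2 the Borda score equals the first-place count, so no minimal improvement exists, and for k = 1 the top of the sole ballot always wins. *)

theory Defs
  imports Complex_Main "HOL-Combinatorics.Multiset_Permutations"
begin

text \<open>
  The candidate $p_j$ is represented by its index \<open>j \<in> {1..m}\<close>.  A ballot is a list of candidates, most
  preferred first; it is a strict complete ranking iff it lies in
  \<^term>\<open>permutations_of_set {1..m}\<close>, i.e. iff it lists every candidate exactly once.
\<close>

type_synonym ballot = "nat list"
type_synonym profile = "ballot list"

definition profiles :: "nat \<Rightarrow> nat \<Rightarrow> profile set" where
  "profiles m k = {P. length P = k \<and> set P \<subseteq> permutations_of_set {1..m}}"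

text \<open>Positions are counted from 1, the top of the ballot.\<close>

definition position :: "ballot \<Rightarrow> nat \<Rightarrow> nat" where
  "position R c = length (takeWhile (\<lambda>d. d \<noteq> c) R) + 1"

definition borda :: "nat \<Rightarrow> profile \<Rightarrow> nat \<Rightarrow> nat" where
  "borda m P c = (\<Sum>R\<leftarrow>P. m - position R c)"

definition first_count :: "profile \<Rightarrow> nat \<Rightarrow> nat" where
  "first_count P c = length (filter (\<lambda>R. position R c = 1) P)"

definition borda_max :: "nat \<Rightarrow> profile \<Rightarrow> nat" where
  "borda_max m P = Max (borda m P ` {1..m})"

definition popular :: "real \<Rightarrow> profile \<Rightarrow> nat \<Rightarrow> bool" where
  "popular \<alpha> P c \<longleftrightarrow> int (first_count P c) \<ge> \<lceil>\<alpha> * real (length P)\<rceil>"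

definition hybrid :: "real \<Rightarrow> nat \<Rightarrow> profile \<Rightarrow> nat \<Rightarrow> real" where
  "hybrid lam m P c =
     (1 - lam) * (real (borda m P c) / (real (length P) * (real m - 1)))
     + lam * (real (first_count P c) / real (length P))"

text \<open>The maximizer of \<open>f\<close> on \<open>S\<close>, with ties broken in favour of the lowest index.\<close>

definition lex_arg_max :: "(nat \<Rightarrow> 'b::linorder) \<Rightarrow> nat set \<Rightarrow> nat" where
  "lex_arg_max f S = (LEAST c. is_arg_max f (\<lambda>c. c \<in> S) c)"

definition borda_winner :: "nat \<Rightarrow> profile \<Rightarrow> nat" where
  "borda_winner m P = lex_arg_max (borda m P) {1..m}"

definition eligible :: "real \<Rightarrow> real \<Rightarrow> nat \<Rightarrow> profile \<Rightarrow> nat set" where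
  "eligible \<alpha> \<beta> m P =
     {c \<in> {1..m}. popular \<alpha> P c \<and> real (borda m P c) \<ge> \<beta> * real (borda_max m P)}"

definition chb :: "real \<Rightarrow> real \<Rightarrow> real \<Rightarrow> nat \<Rightarrow> profile \<Rightarrow> nat" where
  "chb \<alpha> \<beta> lam m P =
     (if popular \<alpha> P (borda_winner m P) then borda_winner m P
      else if eligible \<alpha> \<beta> m P \<noteq> {} then lex_arg_max (hybrid lam m P) (eligible \<alpha> \<beta> m P)
      else borda_winner m P)"

text \<open>
  The changed ballot may be any strict complete ranking: the positions of the other candidates
  are not required to keep their relative order.
\<close>

definition minimal_improvement :: "nat \<Rightarrow> nat \<Rightarrow> profile \<Rightarrow> profile \<Rightarrow> bool" where
  "minimal_improvement m j P P' \<longleftrightarrow>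
     (\<exists>i < length P. \<exists>R \<in> permutations_of_set {1..m}. P' = P[i := R])
     \<and> borda m P' j = borda m P j + 1
     \<and> first_count P' j = first_count P j"

definition fine_grained_responsive :: "nat \<Rightarrow> nat \<Rightarrow> (profile \<Rightarrow> nat) \<Rightarrow> bool" where
  "fine_grained_responsive m k F \<longleftrightarrow>
     (\<forall>j \<in> {1..m}. \<exists>P \<in> profiles m k. \<exists>P' \<in> profiles m k.
        F P \<noteq> j \<and> minimal_improvement m j P P' \<and> F P' = j)"

end

theory Submission
  imports Defs
begin

text \<open>
  A strict Borda winner whose first-place count is also maximal wins under CHB for every choice of
  the parameters: if it is not popular, then nobody is, and the eligible set is empty.  It therefore
  suffices to pass the Borda lead and the first-place lead from another candidate \<open>c\<close> to \<open>j\<close> in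
  one step.  Let half of the ballots (rounded down) begin with \<open>j c x\<close> and all remaining ballots but
  one with \<open>c j x\<close>.  The last ballot changes from \<open>c x j\<close> to \<open>x j c\<close>: this raises \<open>j\<close> by
  a single position, but drops \<open>c\<close> by two.
\<close>

text \<open>Strictness makes the maximizer unique, so tie-breaking by index never comes into
  play.\<close>

lemma lex_arg_max_eq:
  assumes "w \<in> S" and "\<And>y. y \<in> S \<Longrightarrow> y \<noteq> w \<Longrightarrow> f y < f w"
  shows "lex_arg_max f S = w"
proof -
  have "is_arg_max f (\<lambda>c. c \<in> S) c \<longleftrightarrow> c = w" for c
    using assms unfolding is_arg_max_def by (metis order_less_asym)
  then show ?thesis
    unfolding lex_arg_max_def by (intro Least_equality) auto
qed

lemma chb_eqI:
  assumes "w \<in> {1..m}"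
    and "\<And>y. y \<in> {1..m} \<Longrightarrow> y \<noteq> w \<Longrightarrow> borda m P y < borda m P w"
    and "\<And>y. y \<in> {1..m} \<Longrightarrow> y \<noteq> w \<Longrightarrow> first_count P y \<le> first_count P w"
  shows "chb \<alpha> \<beta> lam m P = w"
proof -
  have bw: "borda_winner m P = w"
    unfolding borda_winner_def using assms(1,2) by (intro lex_arg_max_eq) auto
  have "popular \<alpha> P w" if "y \<in> {1..m}" "popular \<alpha> P y" for y
    using that assms(3)[of y] unfolding popular_def by (cases "y = w") auto
  then show ?thesis
    unfolding chb_def bw eligible_def by auto
qed

lemma position_Cons: "position (d # R) c = (if d = c then 1 else position R c + 1)"
  by (simp add: position_def)

lemma position_ge_1: "1 \<le> position R c"
  by (simp add: position_def)

lemma borda_append: "borda m (P @ Q) c = borda m P c + borda m Q c"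
  by (simp add: borda_def)

lemma borda_replicate: "borda m (replicate n R) c = n * (m - position R c)"
  by (simp add: borda_def sum_list_replicate)

lemma borda_singleton: "borda m [R] c = m - position R c"
  by (simp add: borda_def)

lemma first_count_append: "first_count (P @ Q) c = first_count P c + first_count Q c"
  by (simp add: first_count_def)

lemma first_count_replicate:
  "first_count (replicate n R) c = (if position R c = 1 then n else 0)"
  by (simp add: first_count_def)

lemma first_count_singleton: "first_count [R] c = (if position R c = 1 then 1 else 0)"
  by (simp add: first_count_def)

theorem theorem4p8:
  fixes \<alpha> \<beta> lam :: real and m k :: nat
  assumes "\<alpha> \<in> {0..1}" and "\<beta> \<in> {0..1}" and "lam \<in> {0..1}"
    and "m \<ge> 3" and "k \<ge> 2"
  shows "fine_grained_responsive m k (chb \<alpha> \<beta> lam m)"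
  unfolding fine_grained_responsive_def
proof
  fix j assume j: "j \<in> {1..m}"
  have "2 \<le> card ({1..m} - {j})"
    using j \<open>m \<ge> 3\<close> by simp
  then obtain T where T: "T \<subseteq> {1..m} - {j}" "card T = 2"
    by (meson obtain_subset_with_card_n)
  then obtain c x where cx: "T = {c, x}" "c \<noteq> x"
    by (auto simp: card_2_iff)
  have c: "c \<in> {1..m}" and x: "x \<in> {1..m}"
    using T cx by auto
  have neq: "c \<noteq> x" "x \<noteq> c" "c \<noteq> j" "j \<noteq> c" "x \<noteq> j" "j \<noteq> x"
    using T cx by auto
  obtain L where L: "set L = {1..m} - {j, c, x}" "distinct L"
    using finite_distinct_list[of "{1..m} - {j, c, x}"] by auto
  \<comment> \<open>The first three positions now earn \<open>n + 2\<close>, \<open>n + 1\<close>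
    and \<open>n\<close> points, so the scores of \<open>j\<close>, \<open>c\<close> and
    \<open>x\<close> are free of truncated subtraction.\<close>
  obtain n where n: "m = n + 3"
    using \<open>m \<ge> 3\<close> by (metis add.commute le_Suc_ex)
  define a b where "a = k div 2" and "b = (k - 1) div 2"
  \<comment> \<open>For first places, \<open>a \<le> b + 1\<close> keeps \<open>j\<close> from
    overtaking \<open>c\<close> before the change and \<open>b \<le> a\<close> keeps
    \<open>c\<close> from overtaking \<open>j\<close> after it. The bound \<open>1 \<le> a\<close>,
    which rests on \<open>k \<ge> 2\<close>, matches the one first place that \<open>x\<close>
    gains.\<close>
  have ab: "a + b + 1 = k" "1 \<le> a" "a \<le> b + 1" "b \<le> a"
    using \<open>k \<ge> 2\<close> unfolding a_def b_def by linarith+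
  define Q where "Q = replicate a (j # c # x # L) @ replicate b (c # j # x # L)"
  define P where "P = Q @ [c # x # j # L]"
  define P' where "P' = Q @ [x # j # c # L]"
  have all: "insert j (insert c (insert x (set L))) = {1..m}"
    using L(1) j c x by blast
  have perms: "j # c # x # L \<in> permutations_of_set {1..m}"
    "c # j # x # L \<in> permutations_of_set {1..m}"
    "c # x # j # L \<in> permutations_of_set {1..m}"
    "x # j # c # L \<in> permutations_of_set {1..m}"
    \<comment> \<open>The instances of \<open>insert_commute\<close> are oriented so as to sort the
      heads into the order \<open>j\<close>, \<open>c\<close>, \<open>x\<close>, in which
      \<open>all\<close> applies.\<close>
    using neq L(2) by (simp_all only: permutations_of_set_def mem_Collect_eq list.set distinct.simps
      insert_commute[of c j] insert_commute[of x j] insert_commute[of x c] all) (simp_all add: L(1))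
  have profs: "P \<in> profiles m k" "P' \<in> profiles m k"
    using perms ab unfolding profiles_def P_def P'_def Q_def by auto
  note counts = P_def P'_def Q_def borda_append borda_replicate borda_singleton
    first_count_append first_count_replicate first_count_singleton position_Cons neq n
  \<comment> \<open>Before the change \<open>c\<close> leads \<open>j\<close> by
    \<open>b + 2 - a\<close> points, afterwards \<open>j\<close> leads \<open>c\<close> by
    \<open>a + 1 - b\<close>; by \<open>ab\<close> both leads are at least 1.\<close>
  have top: "borda m P c = a * (n + 1) + b * (n + 2) + (n + 2)"
    "borda m P j = a * (n + 2) + b * (n + 1) + n"
    "borda m P x = a * n + b * n + (n + 1)"
    "borda m P' c = a * (n + 1) + b * (n + 2) + n"
    "borda m P' j = a * (n + 2) + b * (n + 1) + (n + 1)"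
    "borda m P' x = a * n + b * n + (n + 2)"
    using position_ge_1[of L] by (simp_all add: counts)
  have first: "first_count P c = b + 1" "first_count P j = a" "first_count P x = 0"
    "first_count P' c = b" "first_count P' j = a" "first_count P' x = 1"
    using position_ge_1[of L] by (simp_all add: counts)
  have rest: "borda m P y \<le> a * n + b * n + n" "borda m P' y \<le> a * n + b * n + n"
    "first_count P y = 0" "first_count P' y = 0"
    if "y \<noteq> j" "y \<noteq> c" "y \<noteq> x" for y
  proof -
    \<comment> \<open>Behind the three heads, \<open>y\<close> earns \<open>n - position L y\<close>
      points on each of the \<open>k\<close> ballots. Rewriting \<open>k\<close> as
      \<open>a + b + 1\<close> splits the bound to fit the blocks of the profile.\<close>
    have "k * (n - position L y) \<le> k * n"
      by simp
    then show "borda m P y \<le> a * n + b * n + n" "borda m P' y \<le> a * n + b * n + n"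
      "first_count P y = 0" "first_count P' y = 0"
      using that that[symmetric] position_ge_1[of L y]
      by (simp_all add: counts algebra_simps flip: ab(1))
  qed
  have "chb \<alpha> \<beta> lam m P = c"
  proof (rule chb_eqI[OF c])
    fix y assume "y \<noteq> c"
    then consider "y = j" | "y = x" | "y \<noteq> j" "y \<noteq> c" "y \<noteq> x" by blast
    then show "borda m P y < borda m P c" "first_count P y \<le> first_count P c"
      using ab rest[of y] by (cases; simp add: top first)+
  qed
  moreover have "chb \<alpha> \<beta> lam m P' = j"
  proof (rule chb_eqI[OF j])
    fix y assume "y \<noteq> j"
    then consider "y = c" | "y = x" | "y \<noteq> j" "y \<noteq> c" "y \<noteq> x" by blast
    then show "borda m P' y < borda m P' j" "first_count P' y \<le> first_count P' j"
      using ab rest[of y] by (cases; simp add: top first)+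
  qed
  moreover have "minimal_improvement m j P P'"
    unfolding minimal_improvement_def
  proof (intro conjI)
    have "P' = P[length Q := x # j # c # L]" "length Q < length P"
      by (simp_all add: P_def P'_def)
    then show "\<exists>i<length P. \<exists>R\<in>permutations_of_set {1..m}. P' = P[i := R]"
      using perms(4) by blast
  \<comment> \<open>The last ballot has \<open>j\<close> third before and second after, never on
    top, so only its Borda score moves.\<close>
  qed (simp_all add: top first)
  ultimately show "\<exists>P\<in>profiles m k. \<exists>P'\<in>profiles m k.
      chb \<alpha> \<beta> lam m P \<noteq> j \<and> minimal_improvement m j P P' \<and> chb \<alpha> \<beta> lam m P' = j"
    using profs neq by blast
qed

end
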